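(* Let $q$ be a prime power, $k,m$ positive integers, and let $U$ be an $\mathbb{F}_q$-subspace of $\mathbb{F}_{q^m}^k$ of dimension $\frac{m(k+1)}{2}-1$ such that $L_U$ is an $(m-1)$-club in $\mathrm{PG}(k-1,q^m)$. Then, up to $\Gamma\mathrm{L}(k,q^m)$-equivalence, $U=U'\oplus U''$, where $U'\subseteq W$ for a $(k-1)$-dimensional $\mathbb{F}_{q^m}$-subspace $W$ with $L_{U'}$ a maximum scattered $\mathbb{F}_q$-linear set in the hyperplane $H=\mathrm{PG}(W,\mathbb{F}_{q^m})$, and $U''$ is an $(m-1)$-dimensional $\mathbb{F}_q$-subspace of $\langle x\rangle_{\mathbb{F}_{q^m}}$ for some point $\langle x\rangle_{\mathbb{F}_{q^m}}\notin H$. Moreover, $L_{U^{\perp'}}$ is a scattered $\mathbb{F}_q$-linear set.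
   Context: $\mathbb{F}_{q^m}^k$ is regarded both as an $\mathbb{F}_{q^m}$-space and as an $mk$-dimensional $\mathbb{F}_q$-space. For an $\mathbb{F}_q$-subspace $U$, $L_U=\{\langle u\rangle_{\mathbb{F}_{q^m}} : u\in U\setminus\{0\}\}$; the weight of a point $\langle v\rangle_{\mathbb{F}_{q^m}}$ is $\dim_{\mathbb{F}_q}(U\cap\langle v\rangle_{\mathbb{F}_{q^m}})$. $L_U$ is scattered if all its points have weight $1$; an $i$-club if exactly one point has weight $i$ and all others weight $1$. For an $r$-dimensional $\mathbb{F}_{q^m}$-subspace $W$, $L_{U'}$ with $U'\subseteq W$ is maximum scattered in $\mathrm{PG}(W,\mathbb{F}_{q^m})$ if it is scattered and $\dim_{\mathbb{F}_q}U'=rm/2$. Two $\mathbb{F}_q$-subspaces $U,\bar U$ of $\mathbb{F}_{q^m}^k$ are $\Gamma\mathrm{L}(k,q^m)$-equivalent if there exist $A\in\mathrm{GL}(k,q^m)$ and a field automorphism $\sigma$ of $\mathbb{F}_{q^m}$ with $\bar U=\{A(u^\sigma): u\in U\}$ ($\sigma$ applied coordinatewise). Duality: fix a non-degenerate reflexive sesquilinear form $\sigma_0$ on $\mathbb{F}_{q^m}^k$, let $\sigma_0'(u,v)=\mathrm{Tr}_{q^m/q}(\sigma_0(u,v))$, and $U^{\perp'}=\{v : \sigma_0'(u,v)=0\ \forall u\in U\}$ (different choices of $\sigma_0$ give $\Gamma\mathrm{L}(k,q^m)$-equivalent $U^{\perp'}$). *)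

theory Defs
  imports "HOL-Analysis.Analysis"
begin

text \<open>
  The extension of finite fields is given by a ring homomorphism \<open>\<iota>\<close> from a finite field
  type \<open>'q\<close> with \<open>q\<close> elements into a finite field type \<open>'a\<close> with \<open>q ^ m\<close> elements. The space of
  \<open>k\<close>-tuples is \<open>'a ^ 'k\<close>; its structure over \<open>'a\<close> is the library one (\<open>vec.subspace\<close>, \<open>vec.dim\<close>,
  \<open>vec.span\<close>), and the structure over \<open>'q\<close> is obtained by restricting scalars along \<open>\<iota>\<close>.
\<close>

definition field_embedding :: "('q::field \<Rightarrow> 'a::field) \<Rightarrow> bool" where
  "field_embedding \<iota> \<longleftrightarrow>
     \<iota> 1 = 1 \<and> (\<forall>x y. \<iota> (x + y) = \<iota> x + \<iota> y) \<and> (\<forall>x y. \<iota> (x * y) = \<iota> x * \<iota> y)"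

definition field_automorphism :: "('a::field \<Rightarrow> 'a) \<Rightarrow> bool" where
  "field_automorphism \<theta> \<longleftrightarrow> field_embedding \<theta> \<and> bij \<theta>"

definition fq_scale :: "('q::field \<Rightarrow> 'a::field) \<Rightarrow> 'q \<Rightarrow> 'a ^ 'k \<Rightarrow> 'a ^ 'k" where
  "fq_scale \<iota> c v = \<iota> c *s v"

lemma vector_space_fq_scale:
  assumes "field_embedding \<iota>"
  shows "vector_space (fq_scale \<iota>)"
  using assms
  by unfold_locales
    (simp_all add: field_embedding_def fq_scale_def vec.scale_right_distrib vec.scale_left_distrib)

abbreviation fq_subspace :: "('q::field \<Rightarrow> 'a::field) \<Rightarrow> ('a ^ 'k) set \<Rightarrow> bool" where
  "fq_subspace \<iota> \<equiv> module.subspace (fq_scale \<iota>)"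

abbreviation fq_dim :: "('q::field \<Rightarrow> 'a::field) \<Rightarrow> ('a ^ 'k) set \<Rightarrow> nat" where
  "fq_dim \<iota> \<equiv> vector_space.dim (fq_scale \<iota>)"

definition linear_set :: "('a::field ^ 'k) set \<Rightarrow> ('a ^ 'k) set set" where
  "linear_set U = {vec.span {u} | u. u \<in> U \<and> u \<noteq> 0}"

definition weight :: "('q::field \<Rightarrow> 'a::field) \<Rightarrow> ('a ^ 'k) set \<Rightarrow> ('a ^ 'k) set \<Rightarrow> nat" where
  "weight \<iota> U P = fq_dim \<iota> (U \<inter> P)"

definition scattered :: "('q::field \<Rightarrow> 'a::field) \<Rightarrow> ('a ^ 'k) set \<Rightarrow> bool" where
  "scattered \<iota> U \<longleftrightarrow> (\<forall>P \<in> linear_set U. weight \<iota> U P = 1)"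

definition club :: "('q::field \<Rightarrow> 'a::field) \<Rightarrow> nat \<Rightarrow> ('a ^ 'k) set \<Rightarrow> bool" where
  "club \<iota> i U \<longleftrightarrow>
     (\<exists>!P. P \<in> linear_set U \<and> weight \<iota> U P = i) \<and>
     (\<forall>P \<in> linear_set U. weight \<iota> U P \<noteq> i \<longrightarrow> weight \<iota> U P = 1)"

definition maximum_scattered_in ::
  "('q::field \<Rightarrow> 'a::field) \<Rightarrow> nat \<Rightarrow> ('a ^ 'k) set \<Rightarrow> ('a ^ 'k) set \<Rightarrow> bool" where
  "maximum_scattered_in \<iota> m W U' \<longleftrightarrow>
     U' \<subseteq> W \<and> fq_subspace \<iota> U' \<and> scattered \<iota> U' \<and>
     real (fq_dim \<iota> U') = real (vec.dim W) * real m / 2"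

definition gammaL_equivalent :: "('a::field ^ 'k) set \<Rightarrow> ('a ^ 'k) set \<Rightarrow> bool" where
  "gammaL_equivalent U V \<longleftrightarrow>
     (\<exists>(A :: 'a ^ 'k ^ 'k) \<theta>. invertible A \<and> field_automorphism \<theta> \<and>
        V = (\<lambda>u. A *v (\<chi> i. \<theta> (u $ i))) ` U)"

definition direct_sum :: "('a::field ^ 'k) set \<Rightarrow> ('a ^ 'k) set \<Rightarrow> ('a ^ 'k) set \<Rightarrow> bool" where
  "direct_sum V U' U'' \<longleftrightarrow> V = {a + b | a b. a \<in> U' \<and> b \<in> U''} \<and> U' \<inter> U'' = {0}"

definition sesquilinear_form :: "('a::field ^ 'k \<Rightarrow> 'a ^ 'k \<Rightarrow> 'a) \<Rightarrow> bool" where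
  "sesquilinear_form \<beta> \<longleftrightarrow>
     (\<exists>\<theta>. field_automorphism \<theta> \<and>
       (\<forall>u u' v. \<beta> (u + u') v = \<beta> u v + \<beta> u' v) \<and>
       (\<forall>u v v'. \<beta> u (v + v') = \<beta> u v + \<beta> u v') \<and>
       (\<forall>a u v. \<beta> (a *s u) v = a * \<beta> u v) \<and>
       (\<forall>a u v. \<beta> u (a *s v) = \<theta> a * \<beta> u v))"

definition reflexive_form :: "('a::field ^ 'k \<Rightarrow> 'a ^ 'k \<Rightarrow> 'a) \<Rightarrow> bool" where
  "reflexive_form \<beta> \<longleftrightarrow> (\<forall>u v. \<beta> u v = 0 \<longrightarrow> \<beta> v u = 0)"

definition nondegenerate_form :: "('a::field ^ 'k \<Rightarrow> 'a ^ 'k \<Rightarrow> 'a) \<Rightarrow> bool" where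
  "nondegenerate_form \<beta> \<longleftrightarrow>
     (\<forall>u. (\<forall>v. \<beta> u v = 0) \<longrightarrow> u = 0) \<and> (\<forall>v. (\<forall>u. \<beta> u v = 0) \<longrightarrow> v = 0)"

text \<open>
  The relative trace of the extension of degree \<open>m\<close> over the field with \<open>q\<close> elements. Its values
  lie in the copy \<open>range \<iota>\<close> of the small field, but are kept in \<open>'a\<close>.
\<close>

definition rel_trace :: "nat \<Rightarrow> nat \<Rightarrow> 'a::field \<Rightarrow> 'a" where
  "rel_trace q m x = (\<Sum>i<m. x ^ (q ^ i))"

definition trace_perp ::
  "nat \<Rightarrow> nat \<Rightarrow> ('a::field ^ 'k \<Rightarrow> 'a ^ 'k \<Rightarrow> 'a) \<Rightarrow> ('a ^ 'k) set \<Rightarrow> ('a ^ 'k) set" where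
  "trace_perp q m \<beta> U = {v. \<forall>u \<in> U. rel_trace q m (\<beta> u v) = 0}"

end

theory Submission
  imports Defs "HOL-Computational_Algebra.Polynomial"
begin

text \<open>
  Let \<open>P = \<langle>x\<rangle>\<close> be the point of weight \<open>m - 1\<close>, so that \<open>U \<inter> P\<close> is an \<open>F\<^sub>q\<close>-hyperplane of \<open>P\<close>.

  Take an \<open>F\<^sub>q\<close>-linear functional \<open>\<phi>\<close> on the whole space that vanishes on \<open>U\<close> but not on \<open>P\<close>, and
  let \<open>W\<close> be the largest subspace over the big field on which \<open>\<phi>\<close> vanishes. Then \<open>W\<close> is a
  hyperplane complementary to \<open>P\<close>. If \<open>u \<in> U\<close> has component \<open>a x\<close> along \<open>P\<close>, then \<open>\<phi> (a x) = 0\<close>,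
  which forces \<open>a x \<in> U \<inter> P\<close>; hence \<open>U = (U \<inter> W) \<oplus> (U \<inter> P)\<close>, and the equivalence is the identity.

  For a scalar \<open>s\<close> outside \<open>F\<^sub>q\<close>, points of weight 1 do not contribute to \<open>U \<inter> s U\<close>, so
  \<open>U \<inter> s U\<close> lies in \<open>U \<inter> P\<close>, and it is smaller because an \<open>F\<^sub>q\<close>-hyperplane of \<open>P\<close> is not stable
  under \<open>s\<close>. Hence \<open>U + s U\<close> is the whole space by dimension. If now \<open>v\<close> and \<open>a v\<close> are both in the
  dual of \<open>U\<close> with \<open>a\<close> outside \<open>F\<^sub>q\<close>, moving \<open>a\<close> to the other argument of the form gives a scalar
  \<open>s\<close> such that \<open>v\<close> is orthogonal to \<open>U + s U\<close>, and \<open>v = 0\<close>.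
\<close>

section \<open>Counting in finite vector spaces and finite fields\<close>

lemma card_span_independent:
  fixes scale :: "'f::{field,finite} \<Rightarrow> 'v::ab_group_add \<Rightarrow> 'v"
  assumes "vector_space scale" and "finite B" and "\<not> module.dependent scale B"
  shows "card (module.span scale B) = CARD('f) ^ card B"
proof -
  interpret vector_space scale by fact
  show ?thesis
    using assms(2,3)
  proof (induction B rule: finite_induct)
    case empty
    then show ?case by simp
  next
    case (insert b B)
    have b: "b \<notin> span B" and B: "independent B"
      using insert.prems insert.hyps independent_insert by auto
    \<comment> \<open>Independence makes the pair \<open>(c, v)\<close> unique, so adjoining
      \<open>b\<close> multiplies the cardinality by the order of the field.\<close>
    have "bij_betw (\<lambda>(c, v). scale c b + v) (UNIV \<times> span B) (span (insert b B))"
    proof (rule bij_betwI')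
      fix p p' :: "'f \<times> 'v" assume "p \<in> UNIV \<times> span B" "p' \<in> UNIV \<times> span B"
      then obtain c v c' v' where p: "p = (c, v)" "p' = (c', v')" "v \<in> span B" "v' \<in> span B"
        by auto
      have "c = c' \<and> v = v'" if eq: "scale c b + v = scale c' b + v'"
      proof -
        have *: "scale (c - c') b = v' - v"
          using eq by (simp add: scale_left_diff_distrib algebra_simps)
        have "c = c'"
        proof (rule ccontr)
          assume "c \<noteq> c'"
          then have "b = scale (inverse (c - c')) (scale (c - c') b)" by simp
          also have "\<dots> \<in> span B" unfolding * using p by (simp add: span_diff span_scale)
          finally show False using b by simp
        qed
        then show ?thesis using eq by simp
      qed
      then show "(case p of (c, v) \<Rightarrow> scale c b + v) = (case p' of (c, v) \<Rightarrow> scale c b + v) \<longleftrightarrow> p = p'"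
        using p by auto
    next
      fix p :: "'f \<times> 'v" assume "p \<in> UNIV \<times> span B"
      then show "(case p of (c, v) \<Rightarrow> scale c b + v) \<in> span (insert b B)"
        by (auto simp: span_base span_scale intro!: span_add intro: span_mono[THEN subsetD])
    next
      fix y assume "y \<in> span (insert b B)"
      then obtain c where "y - scale c b \<in> span B" by (auto simp: span_breakdown_eq)
      then show "\<exists>p \<in> UNIV \<times> span B. y = (case p of (c, v) \<Rightarrow> scale c b + v)"
        by (intro bexI[of _ "(c, y - scale c b)"]) auto
    qed
    then have "card (span (insert b B)) = card ((UNIV :: 'f set) \<times> span B)"
      by (simp add: bij_betw_same_card)
    with insert B show ?case by (simp add: card_cartesian_product)
  qed
qed

lemma card_subspace:
  fixes scale :: "'f::{field,finite} \<Rightarrow> 'v::ab_group_add \<Rightarrow> 'v"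
  assumes "vector_space scale" and "module.subspace scale S" and "finite S"
  shows "card S = CARD('f) ^ vector_space.dim scale S"
proof -
  interpret vector_space scale by fact
  obtain B where B: "B \<subseteq> S" "independent B" "S \<subseteq> span B" "card B = dim S"
    by (rule basis_exists)
  have "span B = S"
    using B(1,3) assms(2) by (rule span_subspace)
  have "finite B" using B(1) assms(3) by (rule finite_subset)
  from card_span_independent[OF assms(1) this B(2)]
  show ?thesis by (simp only: \<open>span B = S\<close> B(4))
qed

text \<open>Multiplication by a nonzero \<open>x\<close> permutes the nonzero elements; comparing
  their product before and after gives the exponent.\<close>

lemma power_card_field_eq_self:
  fixes x :: "'a::{field,finite}"
  shows "x ^ CARD('a) = x"
proof (cases "x = 0")
  case False
  let ?A = "UNIV - {0 :: 'a}"
  have "\<Prod>?A = (\<Prod>y\<in>?A. x * y)"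
    by (rule prod.reindex_bij_witness[of _ "\<lambda>y. x * y" "\<lambda>y. y / x"]) (use False in auto)
  also have "\<dots> = x ^ card ?A * \<Prod>?A" by (simp add: prod.distrib)
  finally have "x ^ card ?A = 1" by simp
  moreover have "CARD('a) = Suc (card ?A)"
    by (simp add: card_Diff_singleton)
  ultimately show ?thesis by (metis mult.right_neutral power_Suc)
qed simp

section \<open>Field embeddings\<close>

lemma field_embedding_0:
  assumes "field_embedding \<iota>" shows "\<iota> 0 = 0"
proof -
  have "\<iota> (0 + 0) = \<iota> 0 + \<iota> 0" using assms unfolding field_embedding_def by blast
  then have "\<iota> 0 = \<iota> 0 + \<iota> 0" by (simp only: add_0_left)
  then show ?thesis by (metis add_left_cancel add.right_neutral)
qed

lemma field_embedding_power:
  assumes "field_embedding \<iota>" shows "\<iota> (x ^ n) = \<iota> x ^ n"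
proof -
  have "\<iota> 1 = 1" "\<And>x y. \<iota> (x * y) = \<iota> x * \<iota> y"
    using assms unfolding field_embedding_def by blast+
  then show ?thesis by (induction n) simp_all
qed

lemma field_embedding_of_nat:
  assumes "field_embedding \<iota>" shows "\<iota> (of_nat n) = of_nat n"
proof -
  have "\<iota> 1 = 1" "\<And>x y. \<iota> (x + y) = \<iota> x + \<iota> y"
    using assms unfolding field_embedding_def by blast+
  then show ?thesis using field_embedding_0[OF assms] by (induction n) simp_all
qed

lemma field_embedding_diff:
  assumes "field_embedding \<iota>" shows "\<iota> (x - y) = \<iota> x - \<iota> y"
proof -
  have "\<iota> ((x - y) + y) = \<iota> (x - y) + \<iota> y" using assms unfolding field_embedding_def by blast
  then show ?thesis by (simp add: algebra_simps)
qed

lemma field_embedding_inj: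
  assumes "field_embedding \<iota>" shows "inj \<iota>"
proof (rule injI, rule ccontr)
  fix x y assume eq: "\<iota> x = \<iota> y" and "x \<noteq> y"
  then have "\<iota> ((x - y) * inverse (x - y)) = 1"
    using assms by (simp add: field_embedding_def)
  moreover have "\<iota> ((x - y) * inverse (x - y)) = \<iota> (x - y) * \<iota> (inverse (x - y))"
    using assms unfolding field_embedding_def by blast
  ultimately show False using eq by (simp add: field_embedding_diff[OF assms])
qed

section \<open>Frobenius map and relative trace of the extension\<close>

locale finite_field_extension =
  fixes \<iota> :: "'q::{field,finite} \<Rightarrow> 'a::{field,finite}"
    and q m :: nat
  assumes card_q: "CARD('q) = q"
    and m_pos: "m > 0"
    and card_a: "CARD('a) = q ^ m"
    and emb: "field_embedding \<iota>"
begin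

lemma emb_simps [simp]:
  "\<iota> 1 = 1" "\<iota> 0 = 0" "\<iota> (x + y) = \<iota> x + \<iota> y" "\<iota> (x * y) = \<iota> x * \<iota> y" "\<iota> (x - y) = \<iota> x - \<iota> y"
  using emb field_embedding_0[OF emb] field_embedding_diff[OF emb]
  unfolding field_embedding_def by blast+

lemma q_ge_2: "q \<ge> 2"
proof -
  have "card {0, 1 :: 'q} \<le> CARD('q)" by (rule card_mono) auto
  then show ?thesis by (simp add: card_q)
qed

text \<open>The image supplies \<open>q\<close> roots of \<open>X^q - X\<close>, which has at most
  \<open>q\<close> of them. This recognises F_q inside the big field by an equation alone.\<close>

lemma range_emb: "range \<iota> = {x. x ^ q = x}"
proof (rule card_seteq)
  show "range \<iota> \<subseteq> {x. x ^ q = x}"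
  proof (rule image_subsetI, rule CollectI)
    fix c
    have "\<iota> c ^ q = \<iota> (c ^ CARD('q))" by (simp only: field_embedding_power[OF emb] card_q)
    then show "\<iota> c ^ q = \<iota> c" by (simp only: power_card_field_eq_self)
  qed
  let ?p = "monom 1 q - monom 1 1 :: 'a poly"
  have "coeff ?p q = 1" using q_ge_2 by simp
  then have "?p \<noteq> 0" by (metis coeff_0 zero_neq_one)
  then have "card {x. poly ?p x = 0} \<le> degree ?p" by (rule card_poly_roots_bound)
  also have "degree ?p \<le> q" using q_ge_2 by (intro degree_diff_le) (simp_all add: degree_monom_eq)
  also have "{x. poly ?p x = 0} = {x. x ^ q = x}" by (simp add: poly_monom)
  finally show "card {x::'a. x ^ q = x} \<le> card (range \<iota>)"
    using field_embedding_inj[OF emb] by (simp add: card_image card_q)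
qed simp

text \<open>
  Over the field with \<open>q\<close> elements, \<open>(X + 1)\<^sup>q\<close> and \<open>X\<^sup>q + 1\<close> have the same values and the same
  leading term, so they coincide; this avoids showing that \<open>q\<close> is a power of the characteristic.
\<close>
lemma of_nat_choose_q:
  assumes "0 < i" "i < q"
  shows "of_nat (q choose i) = (0 :: 'a)"
proof -
  let ?p = "[:1, 1:] ^ q :: 'q poly" and ?r = "monom 1 q + 1 :: 'q poly"
  have "?p = ?r"
  proof (rule poly_eqI_degree_lead_coeff)
    show "coeff ?p q = coeff ?r q"
      using q_ge_2 by (simp add: coeff_linear_poly_power)
    show "q \<le> card (UNIV :: 'q set)" by (simp add: card_q)
    show "degree ?p \<le> q" by (rule order_trans[OF degree_power_le]) simp
    show "degree ?r \<le> q" by (intro degree_add_le) (simp_all add: degree_monom_eq)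
    fix z :: 'q
    show "poly ?p z = poly ?r z"
      using power_card_field_eq_self[of z] power_card_field_eq_self[of "1 + z"]
      by (simp add: card_q poly_monom)
  qed
  then have "coeff ?p i = coeff ?r i" by simp
  then have "of_nat (q choose i) = (0 :: 'q)"
    using assms by (simp add: coeff_linear_poly_power)
  then show ?thesis
    using field_embedding_of_nat[OF emb, of "q choose i"] by simp
qed

lemma frobenius_add: "(x + y :: 'a) ^ q = x ^ q + y ^ q"
proof -
  have "(x + y) ^ q = (\<Sum>i\<le>q. of_nat (q choose i) * x ^ i * y ^ (q - i))"
    by (rule binomial_ring)
  also have "\<dots> = (\<Sum>i\<in>{0, q}. of_nat (q choose i) * x ^ i * y ^ (q - i))"
    by (rule sum.mono_neutral_right) (use of_nat_choose_q in auto)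
  also have "\<dots> = x ^ q + y ^ q" using q_ge_2 by simp
  finally show ?thesis .
qed

lemma frobenius_power_add: "(x + y :: 'a) ^ (q ^ i) = x ^ (q ^ i) + y ^ (q ^ i)"
proof (induction i arbitrary: x y)
  case (Suc i)
  show ?case
    by (simp only: power_Suc power_mult frobenius_add Suc)
qed simp

lemma emb_frobenius_power: "\<iota> c ^ (q ^ i) = \<iota> c"
proof (induction i)
  case (Suc i)
  have "\<iota> c ^ q = \<iota> c" using range_emb by blast
  then show ?case
    by (simp only: power_Suc power_mult Suc)
qed simp

lemma rel_trace_add: "rel_trace q m (x + y :: 'a) = rel_trace q m x + rel_trace q m y"
  by (simp add: rel_trace_def frobenius_power_add sum.distrib)

lemma rel_trace_scale: "rel_trace q m (\<iota> c * x) = \<iota> c * rel_trace q m x"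
  by (simp add: rel_trace_def power_mult_distrib emb_frobenius_power sum_distrib_left)

text \<open>The trace is a polynomial function of degree at most \<open>q^(m-1)\<close>, below the
  order of the field. If it vanished everywhere the polynomial would be zero, but its coefficient at
  \<open>X\<close> is 1, coming from \<open>i = 0\<close>.\<close>

lemma rel_trace_nonzero: "\<exists>x :: 'a. rel_trace q m x \<noteq> 0"
proof (rule ccontr)
  assume zero: "\<not> ?thesis"
  let ?p = "\<Sum>i<m. monom 1 (q ^ i) :: 'a poly"
  have "degree ?p \<le> q ^ (m - 1)"
    by (rule degree_sum_le) (use q_ge_2 in \<open>auto simp: degree_monom_eq intro!: power_increasing\<close>)
  also have "\<dots> < CARD('a)"
    unfolding card_a using q_ge_2 m_pos by (intro power_strict_increasing) auto
  finally have "degree ?p < CARD('a)" .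
  then have "?p = 0"
    by (intro poly_eqI_degree[of UNIV])
      (use zero in \<open>auto simp: poly_sum poly_monom rel_trace_def\<close>)
  then have "0 = coeff ?p 1" by simp
  also have "\<dots> = (\<Sum>i<m. if i = 0 then 1 else 0)"
    using q_ge_2 by (auto simp: coeff_sum intro!: sum.cong)
  finally show False using m_pos by simp
qed

text \<open>For nonzero \<open>y\<close> the multiples \<open>c * y\<close> fill the whole field, so
  one of them has nonzero trace.\<close>

lemma rel_trace_nondegenerate:
  assumes "\<And>c. rel_trace q m (c * y :: 'a) = 0"
  shows "y = 0"
proof (rule ccontr)
  assume "y \<noteq> 0"
  obtain x :: 'a where "rel_trace q m x \<noteq> 0" using rel_trace_nonzero by blast
  with assms[of "x / y"] \<open>y \<noteq> 0\<close> show False by simp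
qed

text \<open>F_q is cut out by \<open>x^q = x\<close>, an equation that every automorphism preserves
  and reflects.\<close>

lemma field_automorphism_range_emb:
  assumes "field_automorphism \<theta>"
  shows "\<theta> y \<in> range \<iota> \<longleftrightarrow> y \<in> range \<iota>"
proof -
  have \<theta>: "field_embedding \<theta>" "inj \<theta>"
    using assms by (auto simp: field_automorphism_def bij_def)
  then show ?thesis
    unfolding range_emb
    by (auto simp: inj_eq simp flip: field_embedding_power[OF \<theta>(1)])
qed

end

section \<open>Dimensions over F_q, weights, and the heavy point of the club\<close>

locale club_space = finite_field_extension \<iota> q m
  for \<iota> :: "'q::{field,finite} \<Rightarrow> 'a::{field,finite}" and q m :: nat +
  fixes U :: "('a ^ 'k::finite) set"
  assumes subspace_U: "fq_subspace \<iota> U"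
    and dim_U: "2 * fq_dim \<iota> U + 2 = m * (CARD('k) + 1)"
    and club_U: "club \<iota> (m - 1) U"
begin

text \<open>Extending the empty set gives some basis; it is finite because the whole space is a
  finite type.\<close>

sublocale fq: finite_dimensional_vector_space "fq_scale \<iota> :: 'q \<Rightarrow> 'a ^ 'k \<Rightarrow> 'a ^ 'k"
  "vector_space.extend_basis (fq_scale \<iota>) {}"
proof -
  interpret V: vector_space "fq_scale \<iota> :: 'q \<Rightarrow> 'a ^ 'k \<Rightarrow> 'a ^ 'k"
    by (rule vector_space_fq_scale[OF emb])
  show "finite_dimensional_vector_space (fq_scale \<iota> :: 'q \<Rightarrow> 'a ^ 'k \<Rightarrow> 'a ^ 'k) (V.extend_basis {})"
    by unfold_locales
      (simp_all add: V.independent_extend_basis V.span_extend_basis V.independent_empty)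
qed

lemma card_fq_subspace:
  assumes "fq.subspace S" shows "card S = q ^ fq.dim S"
  using card_subspace[OF vector_space_fq_scale[OF emb] assms] by (simp add: card_q)

lemma fq_dim_eqI:
  assumes "fq.subspace S" and "card S = q ^ n" shows "fq.dim S = n"
  using card_fq_subspace[OF assms(1)] assms(2) q_ge_2 by (simp add: power_inject_exp)

lemma fq_subspace_vec_subspace:
  assumes "vec.subspace S" shows "fq.subspace S"
  using assms unfolding fq.subspace_def vec.subspace_def by (simp add: fq_scale_def)

lemma fq_dim_UNIV: "fq.dim UNIV = m * CARD('k)"
  by (rule fq_dim_eqI) (simp_all add: card_a power_mult)

lemma fq_dim_point:
  assumes "x \<noteq> 0" shows "fq.dim (vec.span {x}) = m"
proof (rule fq_dim_eqI)
  show "fq.subspace (vec.span {x})"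
    by (simp add: fq_subspace_vec_subspace)
  have "inj (\<lambda>a. a *s x)" using assms by (auto intro!: injI)
  then show "card (vec.span {x}) = q ^ m"
    by (simp add: vec.span_singleton card_image card_a)
qed

lemma scatteredI:
  assumes S: "fq.subspace S"
    and "\<And>u a. u \<in> S \<Longrightarrow> u \<noteq> 0 \<Longrightarrow> a *s u \<in> S \<Longrightarrow> a \<in> range \<iota>"
  shows "scattered \<iota> S"
  unfolding scattered_def
proof
  fix P assume "P \<in> linear_set S"
  then obtain u where u: "P = vec.span {u}" "u \<in> S" "u \<noteq> 0" by (auto simp: linear_set_def)
  have "S \<inter> P = fq.span {u}"
    unfolding u(1) vec.span_singleton fq.span_singleton
    using assms(2)[OF u(2,3)] fq.subspace_scale[OF S u(2)] by (auto simp: fq_scale_def)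
  then show "weight \<iota> S P = 1"
    using u(3) by (simp add: weight_def)
qed

text \<open>The F_q-line of \<open>u\<close> sits inside
  \<open>S \<inter> \<langle>u\<rangle>\<close>, and weight 1 makes the two dimensions equal. This
  is the converse direction to \<open>scatteredI\<close>.\<close>

lemma fq_scalar_of_weight_1:
  assumes S: "fq.subspace S" and "weight \<iota> S (vec.span {u}) = 1"
    and u: "u \<in> S" "u \<noteq> 0" and "a *s u \<in> S"
  shows "a \<in> range \<iota>"
proof -
  let ?T = "S \<inter> vec.span {u}"
  have "fq.subspace ?T"
    by (intro fq.subspace_inter S fq_subspace_vec_subspace vec.subspace_span)
  moreover have "fq.span {u} \<subseteq> ?T"
    using calculation u by (intro fq.span_minimal) (auto simp: vec.span_base)
  ultimately have "fq.span {u} = ?T"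
    using assms(2) u by (intro fq.subspace_dim_equal) (auto simp: weight_def)
  moreover have "a *s u \<in> ?T"
    using assms(5) by (simp add: vec.span_base vec.span_scale)
  ultimately have "a *s u \<in> fq.span {u}" by simp
  then obtain c where "a *s u = \<iota> c *s u"
    unfolding fq.span_singleton fq_scale_def by blast
  then show ?thesis using u(2) by simp
qed

text \<open>Collects what is used of the club: \<open>x\<close> spans the heavy point,
  \<open>y\<close> completes its intersection with \<open>U\<close> to the whole point, and away
  from that point \<open>U\<close> behaves as a scattered subspace.\<close>

lemma club_point:
  obtains x y where "x \<in> U" and "x \<noteq> 0"
    and "fq.dim (U \<inter> vec.span {x}) = m - 1"
    and "y \<in> vec.span {x}" and "y \<notin> U"
    and "\<forall>z \<in> vec.span {x}. \<exists>c. z - \<iota> c *s y \<in> U \<inter> vec.span {x}"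
    and "\<forall>u \<in> U - vec.span {x}. \<forall>a. a *s u \<in> U \<longrightarrow> a \<in> range \<iota>"
proof -
  from club_U obtain P where P: "P \<in> linear_set U" "weight \<iota> U P = m - 1"
    and uniq: "\<And>Q. Q \<in> linear_set U \<Longrightarrow> weight \<iota> U Q = m - 1 \<Longrightarrow> Q = P"
    and one: "\<And>Q. Q \<in> linear_set U \<Longrightarrow> weight \<iota> U Q \<noteq> m - 1 \<Longrightarrow> weight \<iota> U Q = 1"
    unfolding club_def by metis
  from P(1) obtain x where x: "x \<in> U" "x \<noteq> 0" and Px: "P = vec.span {x}"
    unfolding linear_set_def by blast
  let ?P = "vec.span {x}"
  have sub: "fq.subspace (U \<inter> ?P)"
    by (intro fq.subspace_inter subspace_U fq_subspace_vec_subspace vec.subspace_span)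
  have dimP: "fq.dim (U \<inter> ?P) = m - 1" using P(2) by (simp add: weight_def Px)
  have "\<not> ?P \<subseteq> U"
  proof
    assume "?P \<subseteq> U"
    then have "U \<inter> ?P = ?P" by blast
    with dimP fq_dim_point[OF x(2)] m_pos show False by simp
  qed
  then obtain y where y: "y \<in> ?P" "y \<notin> U" by blast
  let ?T = "fq.span (insert y (U \<inter> ?P))"
  have span: "fq.span (U \<inter> ?P) = U \<inter> ?P" using sub by (rule fq.span_eq_iff[THEN iffD2])
  have "?T = ?P"
  proof (rule fq.subspace_dim_equal)
    show "?T \<subseteq> ?P"
      using y by (intro fq.span_minimal) (auto simp: fq_subspace_vec_subspace)
    \<comment> \<open>Adjoining \<open>y\<close> raises the dimension from \<open>m - 1\<close> to
      \<open>m\<close>, that of the whole point.\<close>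
    have "y \<notin> fq.span (U \<inter> ?P)" unfolding span using y by blast
    then show "fq.dim ?P \<le> fq.dim ?T"
      using dimP fq_dim_point[OF x(2)] m_pos by (simp add: fq.dim_insert)
  qed (simp_all add: fq_subspace_vec_subspace)
  then have dec: "\<forall>z \<in> ?P. \<exists>c. z - \<iota> c *s y \<in> U \<inter> ?P"
    using fq.span_breakdown_eq[of _ y "U \<inter> ?P"] unfolding span fq_scale_def by blast
  have "a \<in> range \<iota>" if u: "u \<in> U" "u \<notin> ?P" "a *s u \<in> U" for u a
  proof (rule fq_scalar_of_weight_1[OF subspace_U _ u(1) _ u(3)])
    show "u \<noteq> 0" using u(2) vec.span_zero by blast
    then have "vec.span {u} \<in> linear_set U" using u(1) by (auto simp: linear_set_def)
    moreover have "vec.span {u} \<noteq> ?P" using u(2) vec.span_base by blast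
    ultimately show "weight \<iota> U (vec.span {u}) = 1" using uniq one Px by blast
  qed
  then have "\<forall>u \<in> U - ?P. \<forall>a. a *s u \<in> U \<longrightarrow> a \<in> range \<iota>" by blast
  then show thesis by (rule that[OF x dimP y dec])
qed

section \<open>Filling the space by \<open>U + s U\<close>, and the dual of \<open>U\<close>\<close>

lemma sum_scaled_eq_UNIV:
  assumes "s \<notin> range \<iota>"
  shows "{u + v | u v. u \<in> U \<and> v \<in> (*s) s ` U} = UNIV"
proof -
  obtain x y where x: "x \<in> U" "x \<noteq> 0" and dimP: "fq.dim (U \<inter> vec.span {x}) = m - 1"
    and y: "y \<in> vec.span {x}" "y \<notin> U"
    and dec: "\<forall>z \<in> vec.span {x}. \<exists>c. z - \<iota> c *s y \<in> U \<inter> vec.span {x}"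
    and off: "\<forall>u \<in> U - vec.span {x}. \<forall>a. a *s u \<in> U \<longrightarrow> a \<in> range \<iota>"
    by (rule club_point)
  define P where "P = vec.span {x}"
  have P: "vec.subspace P" by (simp add: P_def)
  have subP: "fq.subspace (U \<inter> P)"
    unfolding P_def by (intro fq.subspace_inter subspace_U fq_subspace_vec_subspace vec.subspace_span)
  have l0: "s \<noteq> 0" using assms rangeI[of \<iota> 0] by auto
  have inj: "inj_on ((*s) a) A" if "a \<noteq> 0" for a and A :: "('a ^ 'k) set"
    using that by (auto intro!: inj_onI)
  have sublU: "fq.subspace ((*s) s ` U)"
    unfolding fq.subspace_def
  proof (intro conjI ballI allI)
    show "0 \<in> (*s) s ` U"
      using fq.subspace_0[OF subspace_U] by (intro image_eqI[of _ _ 0]) simp_all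
    show "v + w \<in> (*s) s ` U" if "v \<in> (*s) s ` U" "w \<in> (*s) s ` U" for v w
    proof -
      from that obtain v' w' where "v' \<in> U" "w' \<in> U" "v = s *s v'" "w = s *s w'" by blast
      then have "v + w = s *s (v' + w')" "v' + w' \<in> U"
        using fq.subspace_add[OF subspace_U] by (simp_all add: vec.scale_right_distrib)
      then show ?thesis by blast
    qed
    show "fq_scale \<iota> c v \<in> (*s) s ` U" if "v \<in> (*s) s ` U" for c v
    proof -
      from that obtain u where "u \<in> U" "v = s *s u" by blast
      then have "fq_scale \<iota> c v = s *s fq_scale \<iota> c u" "fq_scale \<iota> c u \<in> U"
        using fq.subspace_scale[OF subspace_U] by (simp_all add: fq_scale_def mult.commute)
      then show ?thesis by blast
    qed
  qed
  have dimlU: "fq.dim ((*s) s ` U) = fq.dim U"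
    by (rule fq_dim_eqI[OF sublU]) (simp add: card_image inj l0 card_fq_subspace[OF subspace_U])
  let ?M = "U \<inter> (*s) s ` U"
  have subM: "fq.subspace ?M" by (intro fq.subspace_inter subspace_U sublU)
  \<comment> \<open>If \<open>s *s u\<close> and \<open>u\<close> both lie in \<open>U\<close> with
    \<open>u\<close> outside \<open>P\<close>, then \<open>off\<close> puts \<open>s\<close> in
    F_q.\<close>
  have Ml: "?M \<subseteq> (*s) s ` (U \<inter> P)"
    using off assms unfolding P_def by blast
  have MP: "?M \<subseteq> U \<inter> P"
  proof
    fix w assume w: "w \<in> ?M"
    with Ml obtain u where "u \<in> P" "w = s *s u" by blast
    then have "w \<in> P" using vec.subspace_scale[OF P] by simp
    with w show "w \<in> U \<inter> P" by blast
  qed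
  \<comment> \<open>Equality would make \<open>U \<inter> P\<close> stable under \<open>s\<close>,
    hence under \<open>t = s - \<iota> c\<close>, where \<open>c\<close> is chosen so that
    \<open>t *s y\<close> lies in \<open>U \<inter> P\<close>. Since \<open>t\<close> then permutes
    \<open>U \<inter> P\<close>, also \<open>y\<close> would lie in \<open>U\<close>.\<close>
  have "?M \<noteq> U \<inter> P"
  proof
    assume "?M = U \<inter> P"
    then have "U \<inter> P = (*s) s ` (U \<inter> P)"
      using Ml by (intro card_seteq) (auto simp: card_image inj l0)
    then have lUP: "s *s u \<in> U \<inter> P" if "u \<in> U \<inter> P" for u using that by blast
    obtain c where c: "s *s y - \<iota> c *s y \<in> U \<inter> P"
      using dec vec.subspace_scale[OF P] y(1) unfolding P_def by blast
    define t where "t = s - \<iota> c"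
    have mu0: "t \<noteq> 0" using assms by (auto simp: t_def)
    have "(*s) t ` (U \<inter> P) \<subseteq> U \<inter> P"
    proof
      fix w assume "w \<in> (*s) t ` (U \<inter> P)"
      then obtain u where "u \<in> U \<inter> P" "w = s *s u - fq_scale \<iota> c u"
        by (auto simp: t_def fq_scale_def vec.scale_left_diff_distrib)
      then show "w \<in> U \<inter> P"
        using lUP fq.subspace_diff[OF subP] fq.subspace_scale[OF subP] by blast
    qed
    then have "(*s) t ` (U \<inter> P) = U \<inter> P"
      by (intro card_seteq) (auto simp: card_image inj mu0)
    moreover have "t *s y \<in> U \<inter> P" using c by (simp add: t_def vec.scale_left_diff_distrib)
    ultimately have "t *s y \<in> (*s) t ` (U \<inter> P)" by simp
    then have "y \<in> U \<inter> P" using mu0 by auto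
    with y(2) show False by blast
  qed
  then have "fq.dim ?M < m - 1"
    using fq.subspace_dim_equal[OF subM subP MP] dimP unfolding P_def by linarith
  moreover have "fq.dim {u + v | u v. u \<in> U \<and> v \<in> (*s) s ` U} + fq.dim ?M = 2 * fq.dim U"
    using fq.dim_sums_Int[OF subspace_U sublU] dimlU by simp
  \<comment> \<open>The intersection has dimension at most \<open>m - 2\<close>, so the sum has at
    least \<open>m (k + 1) - 2 - (m - 2) = m k\<close>, where \<open>k\<close> is
    \<open>CARD('k)\<close>.\<close>
  ultimately have "fq.dim (UNIV :: ('a ^ 'k) set) \<le> fq.dim {u + v | u v. u \<in> U \<and> v \<in> (*s) s ` U}"
    using dim_U unfolding fq_dim_UNIV by simp
  then show ?thesis
    by (intro fq.subspace_dim_equal fq.subspace_sums subspace_U sublU) auto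
qed

lemma trace_perp_scattered:
  assumes "sesquilinear_form \<beta>" and "nondegenerate_form \<beta>"
  shows "fq.subspace (trace_perp q m \<beta> U) \<and> scattered \<iota> (trace_perp q m \<beta> U)"
proof -
  obtain \<theta> where \<theta>: "field_automorphism \<theta>"
    and add1: "\<And>u u' v. \<beta> (u + u') v = \<beta> u v + \<beta> u' v"
    and add2: "\<And>u v v'. \<beta> u (v + v') = \<beta> u v + \<beta> u v'"
    and scale1: "\<And>a u v. \<beta> (a *s u) v = a * \<beta> u v"
    and scale2: "\<And>a u v. \<beta> u (a *s v) = \<theta> a * \<beta> u v"
    using assms(1) unfolding sesquilinear_form_def by blast
  let ?D = "trace_perp q m \<beta> U"
  have zero2: "\<beta> u 0 = 0" for u
    using scale2[of u 0 0] field_embedding_0[of \<theta>] \<theta> by (simp add: field_automorphism_def)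
  have trace_0: "rel_trace q m (0 :: 'a) = 0"
    using rel_trace_scale[of 0 0] by simp
  have D: "fq.subspace ?D"
    unfolding fq.subspace_def
  proof (intro conjI ballI allI)
    show "0 \<in> ?D" by (simp add: trace_perp_def zero2 trace_0)
    show "v + v' \<in> ?D" if "v \<in> ?D" "v' \<in> ?D" for v v'
      using that by (simp add: trace_perp_def add2 rel_trace_add)
    show "fq_scale \<iota> c v \<in> ?D" if "v \<in> ?D" for c v
    proof -
      \<comment> \<open>The companion automorphism may move F_q elementwise but keeps it as a set,
        so the scalar still comes out of the trace.\<close>
      have "\<theta> (\<iota> c) \<in> range \<iota>" using field_automorphism_range_emb[OF \<theta>] by blast
      then obtain d where "\<theta> (\<iota> c) = \<iota> d" by blast
      then show ?thesis
        using that by (simp add: trace_perp_def fq_scale_def scale2 rel_trace_scale)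
    qed
  qed
  moreover have "scattered \<iota> ?D"
  proof (rule scatteredI[OF D], rule ccontr)
    fix v a assume v: "v \<in> ?D" "v \<noteq> 0" and av: "a *s v \<in> ?D" and a: "a \<notin> range \<iota>"
    \<comment> \<open>The scalar for \<open>U + s U\<close> is \<open>\<theta> a\<close>, because
      \<open>\<beta> u (a *s v) = \<beta> (\<theta> a *s u) v\<close>.\<close>
    have "\<theta> a \<notin> range \<iota>" using a field_automorphism_range_emb[OF \<theta>] by blast
    note full = sum_scaled_eq_UNIV[OF this]
    have trace: "rel_trace q m (\<beta> w v) = 0" for w
    proof -
      have "w \<in> {u + v | u v. u \<in> U \<and> v \<in> (*s) (\<theta> a) ` U}" unfolding full by simp
      then obtain u u' where u: "u \<in> U" "u' \<in> U" and w: "w = u + \<theta> a *s u'" by blast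
      have "\<beta> w v = \<beta> u v + \<beta> u' (a *s v)" by (simp add: w add1 scale1 scale2)
      with u v(1) av show ?thesis by (simp add: rel_trace_add trace_perp_def)
    qed
    \<comment> \<open>Replacing \<open>w\<close> by all its multiples upgrades a vanishing trace to
      a vanishing form value.\<close>
    have "\<beta> w v = 0" for w
    proof (rule rel_trace_nondegenerate)
      show "rel_trace q m (c * \<beta> w v) = 0" for c
        using trace[of "c *s w"] by (simp add: scale1)
    qed
    with assms(2) v(2) show False unfolding nondegenerate_form_def by blast
  qed
  ultimately show ?thesis ..
qed


section \<open>Splitting the heavy point off \<open>U\<close>\<close>

lemma ex_functional:
  assumes "y \<notin> U"
  obtains \<phi> :: "'a ^ 'k \<Rightarrow> 'q"
  where "\<And>v w. \<phi> (v + w) = \<phi> v + \<phi> w" and "\<And>c v. \<phi> (\<iota> c *s v) = c * \<phi> v"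
    and "\<And>u. u \<in> U \<Longrightarrow> \<phi> u = 0" and "\<phi> y = 1"
proof -
  interpret pair: vector_space_pair "fq_scale \<iota> :: 'q \<Rightarrow> 'a ^ 'k \<Rightarrow> 'a ^ 'k" "(*) :: 'q \<Rightarrow> 'q \<Rightarrow> 'q"
    by unfold_locales
  obtain B where B: "B \<subseteq> U" "fq.independent B" "U \<subseteq> fq.span B"
    by (rule fq.maximal_independent_subset)
  have span: "fq.span B = U" using B(1,3) subspace_U by (rule fq.span_subspace)
  \<comment> \<open>Since \<open>y\<close> is outside \<open>U = span B\<close>, the values 1 at
    \<open>y\<close> and 0 on \<open>B\<close> can be prescribed together.\<close>
  have "fq.independent (insert y B)"
    using B(2) assms span by (simp add: fq.independent_insert)
  from pair.linear_independent_extend[OF this, of "\<lambda>b. if b = y then 1 else 0"]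
  obtain \<phi> where lin: "Vector_Spaces.linear (fq_scale \<iota>) (*) \<phi>"
    and \<phi>: "\<forall>b \<in> insert y B. \<phi> b = (if b = y then 1 else 0)" by blast
  interpret \<phi>: Vector_Spaces.linear "fq_scale \<iota> :: 'q \<Rightarrow> 'a ^ 'k \<Rightarrow> 'a ^ 'k" "(*) :: 'q \<Rightarrow> 'q \<Rightarrow> 'q" \<phi>
    by (rule lin)
  show thesis
  proof (rule that)
    show "\<phi> (v + w) = \<phi> v + \<phi> w" for v w by (rule \<phi>.add)
    show "\<phi> (\<iota> c *s v) = c * \<phi> v" for c v using \<phi>.scale[of c v] by (simp add: fq_scale_def)
    show "\<phi> y = 1" using \<phi> by simp
    have "\<phi> b = 0" if "b \<in> B" for b using that \<phi> B(1) assms by auto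
    then show "\<phi> u = 0" if "u \<in> U" for u
      using pair.linear_eq_0_on_span[OF lin, of B u] that span by blast
  qed
qed

text \<open>
  For an \<open>F\<^sub>q\<close>-linear functional \<open>\<phi>\<close> that does not vanish on the point \<open>\<langle>x\<rangle>\<close>, the functionals
  \<open>b \<mapsto> \<phi> (b a x)\<close> exhaust the dual of the big field by counting, so each \<open>v\<close> agrees with some
  \<open>a x\<close> modulo the largest subspace over the big field on which \<open>\<phi>\<close> vanishes.
\<close>
lemma functional_radical_complement:
  fixes \<phi> :: "'a ^ 'k \<Rightarrow> 'q"
  assumes add: "\<And>v w. \<phi> (v + w) = \<phi> v + \<phi> w" and scale: "\<And>c v. \<phi> (\<iota> c *s v) = c * \<phi> v"
    and y: "y \<in> vec.span {x}" "\<phi> y \<noteq> 0"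
  shows "\<exists>a. \<forall>b. \<phi> (b *s (v - a *s x)) = 0"
proof -
  define sc where "sc c a = \<iota> c * a" for c a
  have vs: "vector_space sc"
    by unfold_locales (simp_all add: sc_def algebra_simps)
  then interpret K: vector_space sc .
  obtain B where B: "K.independent B" "UNIV \<subseteq> K.span B"
    by (rule K.maximal_independent_subset)
  then have spanB: "K.span B = UNIV" by blast
  have cardB: "q ^ card B = q ^ m"
    using card_span_independent[OF vs finite B(1)] by (simp add: spanB card_a card_q)
  have diff: "\<phi> (v - w) = \<phi> v - \<phi> w" for v w
    using add[of "v - w" w] by (simp add: algebra_simps)
  have zero: "\<phi> 0 = 0" using add[of 0 0] by (simp only: add_0_left) (metis add_left_cancel add.right_neutral)
  \<comment> \<open>\<open>B\<close> spans the big field over F_q, so testing the multiples by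
    \<open>B\<close> tests all multiples.\<close>
  have all: "\<phi> (c *s v) = 0" if "\<forall>b \<in> B. \<phi> (b *s v) = 0" for c v
  proof -
    have "c \<in> K.span B" by (simp add: spanB)
    then show ?thesis
    proof (induction rule: K.span_induct_alt)
      case base
      then show ?case by (simp add: zero)
    next
      case (step d b e)
      have "(sc d b + e) *s v = \<iota> d *s (b *s v) + e *s v"
        by (simp add: sc_def vec.scale_left_distrib)
      with step that show ?case by (simp only: add scale) simp
    qed
  qed
  \<comment> \<open>\<open>T v\<close> encodes \<open>b \<mapsto> \<phi> (b *s v)\<close> by its
    values on the basis \<open>B\<close>. Restricting to \<open>B\<close> puts it in a set of
    exactly \<open>q ^ card B = q ^ m\<close> functions.\<close>
  define T where "T v = restrict (\<lambda>b. \<phi> (b *s v)) B" for v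
  have T: "T v \<in> B \<rightarrow>\<^sub>E UNIV" for v by (simp add: T_def)
  have T_eq: "\<phi> (b *s (v - w)) = 0" if eq: "T v = T w" for v w b
  proof (rule all, rule ballI)
    fix b assume "b \<in> B"
    then show "\<phi> (b *s (v - w)) = 0"
      using fun_cong[OF eq, of b] by (simp add: T_def vec.scale_right_diff_distrib diff)
  qed
  \<comment> \<open>A collision would make \<open>\<phi>\<close> vanish on all multiples of a
    nonzero multiple of \<open>x\<close>, among them \<open>y\<close>.\<close>
  have "inj (\<lambda>a. T (a *s x))"
  proof (rule injI, rule ccontr)
    fix a a' assume eq: "T (a *s x) = T (a' *s x)" and "a \<noteq> a'"
    obtain d where "y = d *s x" using y(1) by (auto simp: vec.span_singleton)
    moreover have "d / (a - a') * (a - a') = d" using \<open>a \<noteq> a'\<close> by simp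
    ultimately have "y = (d / (a - a')) *s ((a - a') *s x)" by (simp only: vec.scale_scale)
    also have "(a - a') *s x = a *s x - a' *s x" by (rule vec.scale_left_diff_distrib)
    finally show False using T_eq[OF eq] y(2) by metis
  qed
  then have "card (range (\<lambda>a. T (a *s x))) = card (B \<rightarrow>\<^sub>E (UNIV :: 'q set))"
    using cardB by (simp add: card_image card_a card_PiE card_q)
  then have "range (\<lambda>a. T (a *s x)) = (B \<rightarrow>\<^sub>E UNIV)"
    using T by (intro card_subset_eq) (auto intro: finite_PiE)
  then obtain a where "T v = T (a *s x)" using T[of v] by blast
  with T_eq[of v "a *s x"] show ?thesis by blast
qed

lemma club_decomposition:
  "\<exists>U' U'' W x. fq.subspace U' \<and> fq.subspace U'' \<and> direct_sum U U' U'' \<and>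
     vec.subspace W \<and> vec.dim W = CARD('k) - 1 \<and> maximum_scattered_in \<iota> m W U' \<and>
     x \<noteq> 0 \<and> \<not> vec.span {x} \<subseteq> W \<and> U'' \<subseteq> vec.span {x} \<and> fq.dim U'' = m - 1"
proof -
  obtain x y where x: "x \<in> U" "x \<noteq> 0" and dimP: "fq.dim (U \<inter> vec.span {x}) = m - 1"
    and y: "y \<in> vec.span {x}" "y \<notin> U"
    and dec: "\<forall>z \<in> vec.span {x}. \<exists>c. z - \<iota> c *s y \<in> U \<inter> vec.span {x}"
    and off: "\<forall>u \<in> U - vec.span {x}. \<forall>a. a *s u \<in> U \<longrightarrow> a \<in> range \<iota>"
    by (rule club_point)
  obtain \<phi> :: "'a ^ 'k \<Rightarrow> 'q"
    where add: "\<And>v w. \<phi> (v + w) = \<phi> v + \<phi> w" and scale: "\<And>c v. \<phi> (\<iota> c *s v) = c * \<phi> v"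
    and \<phi>U: "\<And>u. u \<in> U \<Longrightarrow> \<phi> u = 0" and \<phi>y: "\<phi> y = 1"
    using ex_functional[OF y(2)] by metis
  define W where "W = {w. \<forall>b. \<phi> (b *s w) = 0}"
  define P where "P = vec.span {x}"
  have W: "vec.subspace W"
    using \<phi>U[OF fq.subspace_0[OF subspace_U]]
    by (simp add: vec.subspace_def W_def vec.scale_right_distrib add)
  have subP: "vec.subspace P" by (simp add: P_def)
  have WP: "W \<inter> P = {0}"
  proof
    show "W \<inter> P \<subseteq> {0}"
    proof
      fix w assume w: "w \<in> W \<inter> P"
      then obtain d where d: "w = d *s x" by (auto simp: P_def vec.span_singleton)
      obtain e where e: "y = e *s x" using y(1) by (auto simp: vec.span_singleton)
      \<comment> \<open>Otherwise \<open>y\<close> is a multiple of \<open>w \<in> W\<close>, and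
        \<open>\<phi>\<close> would vanish at \<open>y\<close>.\<close>
      have "d = 0"
      proof (rule ccontr)
        assume "d \<noteq> 0"
        then have "y = (e / d) *s w" by (simp add: d e)
        with w \<phi>y show False by (simp add: W_def)
      qed
      then show "w \<in> {0}" by (simp add: d)
    qed
    show "{0} \<subseteq> W \<inter> P" using vec.subspace_0[OF W] vec.subspace_0[OF subP] by blast
  qed
  have ex: "\<exists>a. v - a *s x \<in> W" for v
    using functional_radical_complement[OF add scale y(1), of v] \<phi>y by (simp add: W_def)
  have sumWP: "{w + p | w p. w \<in> W \<and> p \<in> P} = UNIV"
  proof -
    have "v \<in> {w + p | w p. w \<in> W \<and> p \<in> P}" for v
    proof -
      obtain a where "v - a *s x \<in> W" using ex by blast
      moreover have "a *s x \<in> P" by (simp add: P_def vec.span_base vec.span_scale)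
      ultimately show ?thesis by (intro CollectI exI[of _ "v - a *s x"] exI[of _ "a *s x"]) simp
    qed
    then show ?thesis by blast
  qed
  have dimW: "vec.dim W = CARD('k) - 1"
  proof -
    have "vec.dim {w + p | w p. w \<in> W \<and> p \<in> P} + vec.dim (W \<inter> P) = vec.dim W + vec.dim P"
      by (rule vec.dim_sums_Int[OF W subP])
    then show ?thesis using x(2) unfolding sumWP WP vec_dim_card by (simp add: P_def)
  qed
  let ?U' = "U \<inter> W" and ?U'' = "U \<inter> P"
  have subU': "fq.subspace ?U'" and subU'': "fq.subspace ?U''"
    by (intro fq.subspace_inter subspace_U fq_subspace_vec_subspace W subP)+
  \<comment> \<open>Modulo \<open>U\<close>, \<open>a *s x\<close> is a multiple
    \<open>\<iota> c *s y\<close>, and \<open>\<phi>\<close> reads off \<open>c\<close>; thus the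
    kernel of \<open>\<phi>\<close> on \<open>P\<close> lies in \<open>U\<close>.\<close>
  have in_U: "a *s x \<in> U" if "\<phi> (a *s x) = 0" for a
  proof -
    have "a *s x \<in> vec.span {x}" by (simp add: vec.span_base vec.span_scale)
    then obtain c where c: "a *s x - \<iota> c *s y \<in> U" using dec by blast
    have "\<phi> (a *s x) = \<phi> (a *s x - \<iota> c *s y) + c * \<phi> y"
      using add[of "a *s x - \<iota> c *s y" "\<iota> c *s y"] scale by simp
    then have "c = 0" unfolding that \<phi>U[OF c] \<phi>y by simp
    with c show ?thesis by simp
  qed
  have sumU: "{u + v | u v. u \<in> ?U' \<and> v \<in> ?U''} = U"
  proof
    show "{u + v | u v. u \<in> ?U' \<and> v \<in> ?U''} \<subseteq> U"
      using fq.subspace_add[OF subspace_U] by blast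
    show "U \<subseteq> {u + v | u v. u \<in> ?U' \<and> v \<in> ?U''}"
    proof
      fix u assume u: "u \<in> U"
      obtain a where a: "u - a *s x \<in> W" using ex by blast
      then have "\<phi> (1 *s (u - a *s x)) = 0" unfolding W_def by blast
      with add[of "u - a *s x" "a *s x"] \<phi>U[OF u] have ax: "a *s x \<in> U" by (intro in_U) simp
      have "a *s x \<in> ?U''" using ax by (simp add: P_def vec.span_base vec.span_scale)
      moreover have "u - a *s x \<in> ?U'" using fq.subspace_diff[OF subspace_U u ax] a by blast
      ultimately show "u \<in> {u + v | u v. u \<in> ?U' \<and> v \<in> ?U''}"
        by (intro CollectI exI[of _ "u - a *s x"] exI[of _ "a *s x"]) simp
    qed
  qed
  have int: "?U' \<inter> ?U'' = {0}" using WP fq.subspace_0[OF subspace_U] by blast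
  have "fq.dim U + fq.dim {0} = fq.dim ?U' + fq.dim ?U''"
    using fq.dim_sums_Int[OF subU' subU''] unfolding sumU int .
  then have "fq.dim U = fq.dim ?U' + (m - 1)" using dimP by (simp add: P_def)
  \<comment> \<open>From \<open>2 dim U' = m (k + 1) - 2 - 2 (m - 1) = m (k - 1)\<close>, with
    \<open>k\<close> for \<open>CARD('k)\<close>; moving \<open>m\<close> to the left avoids
    truncated subtraction.\<close>
  with dim_U m_pos have "2 * fq.dim ?U' + m = m * CARD('k)" by simp
  then have "2 * real (fq.dim ?U') + real m = real m * real CARD('k)"
    by (metis of_nat_add of_nat_mult of_nat_numeral)
  moreover have "real (CARD('k) - 1) = real CARD('k) - 1" by (simp add: of_nat_diff Suc_leI)
  ultimately have "real (fq.dim ?U') = real (vec.dim W) * real m / 2"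
    unfolding dimW by (simp add: algebra_simps)
  moreover have "scattered \<iota> ?U'"
  proof (rule scatteredI[OF subU'])
    fix u a assume u: "u \<in> ?U'" "u \<noteq> 0" and au: "a *s u \<in> ?U'"
    \<comment> \<open>A nonzero vector of \<open>W\<close> avoids \<open>P\<close>, so the scattered
      behaviour of \<open>U\<close> off the heavy point applies.\<close>
    then have "u \<notin> vec.span {x}" using WP unfolding P_def by blast
    then show "a \<in> range \<iota>" using off u au by blast
  qed
  ultimately have max: "maximum_scattered_in \<iota> m W ?U'"
    using subU' by (simp add: maximum_scattered_in_def)
  have "\<not> vec.span {x} \<subseteq> W"
    using WP x(2) vec.span_base[of x "{x}"] unfolding P_def by blast
  moreover have "direct_sum U ?U' ?U''" using sumU int by (simp add: direct_sum_def)
  ultimately show ?thesis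
    using subU' subU'' W dimW max x(2) dimP unfolding P_def by blast
qed

end

section \<open>The identity equivalence and the conclusion\<close>

lemma gammaL_equivalent_refl: "gammaL_equivalent U U"
proof -
  have "field_automorphism (id :: 'a \<Rightarrow> 'a)"
    by (simp add: field_automorphism_def field_embedding_def)
  moreover have "invertible (mat 1 :: 'a ^ 'k ^ 'k)"
    unfolding invertible_def by (intro exI[of _ "mat 1"]) simp
  ultimately show ?thesis
    unfolding gammaL_equivalent_def
    by (intro exI[of _ "mat 1"] exI[of _ id]) simp
qed

theorem theorem6p3:
  fixes \<iota> :: "'q::{field,finite} \<Rightarrow> 'a::{field,finite}"
    and q k m :: nat
    and U :: "('a ^ 'k::finite) set"
  assumes "CARD('q) = q"
    and "CARD('k) = k"
    and "m > 0"
    and "CARD('a) = q ^ m"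
    and "field_embedding \<iota>"
    and "fq_subspace \<iota> U"
    and "real (fq_dim \<iota> U) = real m * (real k + 1) / 2 - 1"
    and "club \<iota> (m - 1) U"
  shows "(\<exists>V U' U'' W x.
            gammaL_equivalent U V \<and>
            fq_subspace \<iota> U' \<and> fq_subspace \<iota> U'' \<and> direct_sum V U' U'' \<and>
            vec.subspace W \<and> vec.dim W = k - 1 \<and>
            maximum_scattered_in \<iota> m W U' \<and>
            x \<noteq> 0 \<and> \<not> vec.span {x} \<subseteq> W \<and>
            U'' \<subseteq> vec.span {x} \<and> fq_dim \<iota> U'' = m - 1) \<and>
         (\<forall>\<beta>. sesquilinear_form \<beta> \<and> nondegenerate_form \<beta> \<and> reflexive_form \<beta> \<longrightarrow>
            fq_subspace \<iota> (trace_perp q m \<beta> U) \<and> scattered \<iota> (trace_perp q m \<beta> U))"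
proof -
  \<comment> \<open>Clearing the fraction and the subtraction turns the dimension hypothesis into
    the identity of naturals assumed in \<open>club_space\<close>.\<close>
  have "real (2 * fq_dim \<iota> U + 2) = real (m * (CARD('k) + 1))"
    using assms(2,7) by (simp add: field_simps)
  then have "2 * fq_dim \<iota> U + 2 = m * (CARD('k) + 1)" by (simp only: of_nat_eq_iff)
  with assms interpret club_space \<iota> q m U
    by unfold_locales simp_all
  show ?thesis
    using gammaL_equivalent_refl[of U] club_decomposition trace_perp_scattered assms(2)
    by metis
qed

end
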